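(* Let $R$ be a finite non-commutative ring and let $S$ and $K$ be two subrings of $R$ such that $\Pr(S,K)=\frac{2p-1}{p^2}$ for some prime $p$. Then $p$ divides $|R|$. If $p$ is the smallest prime dividing $|R|$ then \[ \frac{S}{Z(S,K)}\cong \mathbb{Z}_p\cong \frac{K}{Z(K,S)} \] and hence $S\neq K$. In particular, if $\Pr(S,K)=\frac{3}{4}$ then \[ \frac{S}{Z(S,K)}\cong \mathbb{Z}_2\cong \frac{K}{Z(K,S)}. \]
   Context: Rings are associative and need not have an identity; a subring is an additive subgroup closed under multiplication. For subrings $S,K$ of $R$, $\Pr(S,K) := \frac{|\{(s,k)\in S\times K : sk=ks\}|}{|S\times K|}$ and $Z(S,K) := \{s\in S : sk=ks \text{ for all } k\in K\}$ (so $Z(K,S) = \{k\in K : ks=sk \text{ for all } s\in S\}$). Quotients such as $S/Z(S,K)$ are additive factor groups, and $\cong$ denotes isomorphism of additive groups. *)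

theory Defs
  imports
    "HOL-Algebra.AbelCoset"
    "HOL-Algebra.Elementary_Groups"
    "HOL-Computational_Algebra.Primes"
    Complex_Main
begin

text \<open>
  HOL-Algebra's \<open>ring\<close> and \<open>subring\<close> require an identity element. Here rings need not have one:
  the \<open>one\<close> field of the record is left unconstrained and is never used.
\<close>

locale rng = abelian_group R for R (structure) +
  assumes rng_m_closed:
      "\<lbrakk>x \<in> carrier R; y \<in> carrier R\<rbrakk> \<Longrightarrow> x \<otimes> y \<in> carrier R"
    and rng_m_assoc:
      "\<lbrakk>x \<in> carrier R; y \<in> carrier R; z \<in> carrier R\<rbrakk> \<Longrightarrow> (x \<otimes> y) \<otimes> z = x \<otimes> (y \<otimes> z)"
    and rng_l_distr:
      "\<lbrakk>x \<in> carrier R; y \<in> carrier R; z \<in> carrier R\<rbrakk> \<Longrightarrow> (x \<oplus> y) \<otimes> z = x \<otimes> z \<oplus> y \<otimes> z"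
    and rng_r_distr:
      "\<lbrakk>x \<in> carrier R; y \<in> carrier R; z \<in> carrier R\<rbrakk> \<Longrightarrow> z \<otimes> (x \<oplus> y) = z \<otimes> x \<oplus> z \<otimes> y"

locale subrng = additive_subgroup S R for S and R (structure) +
  assumes subrng_m_closed: "\<lbrakk>x \<in> S; y \<in> S\<rbrakk> \<Longrightarrow> x \<otimes> y \<in> S"

definition comm_prob :: "('a, 'b) ring_scheme \<Rightarrow> 'a set \<Rightarrow> 'a set \<Rightarrow> real" where
  "comm_prob R S K =
     real (card {(s, k) \<in> S \<times> K. s \<otimes>\<^bsub>R\<^esub> k = k \<otimes>\<^bsub>R\<^esub> s}) / real (card (S \<times> K))"

definition rel_center :: "('a, 'b) ring_scheme \<Rightarrow> 'a set \<Rightarrow> 'a set \<Rightarrow> 'a set" where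
  "rel_center R S K = {s \<in> S. \<forall>k\<in>K. s \<otimes>\<^bsub>R\<^esub> k = k \<otimes>\<^bsub>R\<^esub> s}"

text \<open>The additive factor group \<open>S / Z(S,K)\<close>; its elements are the cosets \<open>Z(S,K) + s\<close> with \<open>s \<in> S\<close>.\<close>

definition center_quotient :: "('a, 'b) ring_scheme \<Rightarrow> 'a set \<Rightarrow> 'a set \<Rightarrow> 'a set monoid" where
  "center_quotient R S K = (R\<lparr>carrier := S\<rparr>) A_Mod (rel_center R S K)"

end

theory Submission
  imports Defs "HOL-Algebra.Multiplicative_Group"
begin

text \<open>
  If \<open>s \<notin> Z(S,K)\<close>, then the centralizer of \<open>s\<close> in \<open>K\<close> is a proper additive subgroup of \<open>K\<close>, so its index
  is at least the smallest prime divisor \<open>p\<close> of \<open>|R|\<close>. With \<open>m = |S : Z(S,K)|\<close>, counting commuting pairs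
  by their first entry gives \<open>Pr(S,K) \<le> (m + p - 1) / (m p)\<close>. The value \<open>(2p - 1) / p\<^sup>2\<close> thus forces
  \<open>m \<le> p\<close>, while \<open>m \<noteq> 1\<close> because \<open>Pr(S,K) \<noteq> 1\<close>; hence \<open>m = p\<close>, and by symmetry the same holds for \<open>K\<close>.
  Finally \<open>S = K\<close> is impossible: for \<open>s \<in> S\<close> outside \<open>Z(S,S)\<close>, which has prime index, the
  centralizer of \<open>s\<close> in \<open>S\<close> contains both \<open>Z(S,S)\<close> and \<open>s\<close>, so it is all of \<open>S\<close>.
\<close>

section \<open>Groups of prime order and smallest prime divisors\<close>

lemma (in group) prime_order_iso_integer_mod_group:
  assumes "prime (order G)"
  shows "integer_mod_group (order G) \<cong> G"
proof -
  let ?n = "order G"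
  have n: "?n > 1" using assms prime_gt_1_nat by blast
  have fin: "finite (carrier G)"
    using n unfolding order_def by (metis card.infinite not_one_less_zero)
  have "carrier G \<noteq> {\<one>}"
    using n unfolding order_def by auto
  then obtain x where x: "x \<in> carrier G" "x \<noteq> \<one>"
    using one_closed by blast
  \<comment> \<open>In prime order every element other than the identity is a generator, so the
    powers of \<open>x\<close> give the isomorphism.\<close>
  have "ord x dvd ?n" using x ord_dvd_group_order by blast
  moreover have "ord x \<noteq> 1" using x ord_eq_1 by blast
  ultimately have ord: "ord x = ?n" using assms prime_nat_iff by blast
  let ?Z = "integer_mod_group ?n"
  let ?h = "\<lambda>k::int. x [^] k"
  have eq: "?h a = ?h b \<longleftrightarrow> int ?n dvd b - a" for a b
    using int_pow_eq[OF x(1)] ord by simp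
  have hom: "?h \<in> hom ?Z G"
  proof (rule homI)
    fix a b assume "a \<in> carrier ?Z" "b \<in> carrier ?Z"
    \<comment> \<open>Addition in \<open>?Z\<close> reduces modulo \<open>?n\<close>; the power map
      does not see the reduction because \<open>x\<close> has order \<open>?n\<close>.\<close>
    have "?h ((a + b) mod int ?n) = ?h (a + b)"
      by (simp add: eq minus_mod_eq_mult_div)
    then show "?h (a \<otimes>\<^bsub>?Z\<^esub> b) = ?h a \<otimes> ?h b"
      using x by (simp add: int_pow_mult)
  qed (use x in simp)
  have carr: "carrier ?Z = {0..<int ?n}" using n by (simp add: carrier_integer_mod_group)
  have inj: "inj_on ?h (carrier ?Z)"
  proof (rule inj_onI)
    fix a b assume ab: "a \<in> carrier ?Z" "b \<in> carrier ?Z" and "?h a = ?h b"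
    then have "int ?n dvd b - a" using eq by blast
    moreover have "\<bar>b - a\<bar> < int ?n" using ab carr by auto
    ultimately show "a = b" using dvd_imp_le_int[of "b - a" "int ?n"] by fastforce
  qed
  have "?h ` carrier ?Z = carrier G"
  proof (rule card_subset_eq[OF fin])
    show "?h ` carrier ?Z \<subseteq> carrier G" using x by auto
    show "card (?h ` carrier ?Z) = card (carrier G)"
      using card_image[OF inj] carr by (simp add: order_def)
  qed
  then show ?thesis
    using hom inj unfolding is_iso_def iso_def bij_betw_def by blast
qed

text \<open>Every prime factor of \<open>t\<close> also divides \<open>n\<close>. This is applied to
  indices of additive subgroups, which divide the order of the ring.\<close>

lemma least_prime_divisor_le:
  fixes p t n :: nat
  assumes "\<And>q. prime q \<Longrightarrow> q dvd n \<Longrightarrow> p \<le> q" and "t dvd n" "t > 1"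
  shows "p \<le> t"
proof -
  obtain q where q: "prime q" "q dvd t"
    using \<open>t > 1\<close> prime_factor_nat by (metis less_irrefl)
  have "p \<le> q" using assms(1) q assms(2) dvd_trans by blast
  also have "q \<le> t" using q assms(3) by (simp add: dvd_imp_le)
  finally show ?thesis .
qed

section \<open>Counting commuting pairs\<close>

lemma comm_prob_commute: "comm_prob R S K = comm_prob R K S"
proof -
  have "{(k, s) \<in> K \<times> S. k \<otimes>\<^bsub>R\<^esub> s = s \<otimes>\<^bsub>R\<^esub> k}
      = prod.swap ` {(s, k) \<in> S \<times> K. s \<otimes>\<^bsub>R\<^esub> k = k \<otimes>\<^bsub>R\<^esub> s}"
    by force
  then show ?thesis
    unfolding comm_prob_def by (simp add: card_image card_cartesian_product mult.commute)
qed

text \<open>The fibre of the set of commuting pairs over \<open>s\<close> is the centralizer of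
  \<open>s\<close> in \<open>K\<close>, here encoded as \<open>rel_center R K {s}\<close>.\<close>

lemma card_commuting_pairs:
  assumes "finite S" "finite K"
  shows "card {(s, k) \<in> S \<times> K. s \<otimes>\<^bsub>R\<^esub> k = k \<otimes>\<^bsub>R\<^esub> s} = (\<Sum>s\<in>S. card (rel_center R K {s}))"
proof -
  have "{(s, k) \<in> S \<times> K. s \<otimes>\<^bsub>R\<^esub> k = k \<otimes>\<^bsub>R\<^esub> s} = Sigma S (\<lambda>s. rel_center R K {s})"
    by (auto simp: rel_center_def)
  moreover have "\<forall>s\<in>S. finite (rel_center R K {s})"
    using assms by (auto simp: rel_center_def)
  ultimately show ?thesis using assms by simp
qed

lemma comm_prob_eq_1:
  assumes "rel_center R S K = S" "finite S" "finite K" "S \<noteq> {}" "K \<noteq> {}"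
  shows "comm_prob R S K = 1"
proof -
  have "{(s, k) \<in> S \<times> K. s \<otimes>\<^bsub>R\<^esub> k = k \<otimes>\<^bsub>R\<^esub> s} = S \<times> K"
    using assms(1) by (auto simp: rel_center_def)
  then show ?thesis
    using assms unfolding comm_prob_def by (simp add: card_gt_0_iff)
qed

section \<open>Orders of additive subgroups\<close>

lemma (in additive_subgroup) card_pos:
  assumes "finite H"
  shows "card H > 0"
  using assms zero_closed by (metis card_gt_0_iff empty_iff)

lemma (in abelian_group) card_additive_subgroup_dvd:
  assumes "additive_subgroup H G" "additive_subgroup L G" "H \<subseteq> L"
  shows "card H dvd card L"
proof -
  have "subgroup H (add_monoid G\<lparr>carrier := L\<rparr>)"
    using add.subgroup_incl assms additive_subgroup.a_subgroup by blast
  moreover have "group (add_monoid G\<lparr>carrier := L\<rparr>)"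
    using add.subgroup_imp_group assms(2) additive_subgroup.a_subgroup by blast
  ultimately have "card (rcosets\<^bsub>add_monoid G\<lparr>carrier := L\<rparr>\<^esub> H) * card H = card L"
    using group.lagrange by (fastforce simp: order_def)
  then show ?thesis by (metis dvd_triv_right)
qed

section \<open>Relative centers, centralizers and their quotients\<close>

context rng
begin

text \<open>By distributivity, commuting with a fixed element is an additive condition. Since
  \<open>T\<close> is an arbitrary subset, the lemma covers both centers (\<open>T\<close> a
  subring) and centralizers (\<open>T\<close> a singleton).\<close>

lemma additive_subgroup_rel_center:
  assumes "additive_subgroup S R" "T \<subseteq> carrier R"
  shows "additive_subgroup (rel_center R S T) R"
proof (rule additive_subgroupI, rule add.subgroupI)
  interpret S: additive_subgroup S R by fact
  show "rel_center R S T \<subseteq> carrier R"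
    using S.a_subset by (auto simp: rel_center_def)
  \<comment> \<open>That zero is absorbing is not an axiom of \<open>rng\<close>; it follows from
    distributivity and cancellation.\<close>
  have "\<zero> \<otimes> k = \<zero>" "k \<otimes> \<zero> = \<zero>" if "k \<in> carrier R" for k
  proof -
    have "\<zero> \<otimes> k \<oplus> \<zero> \<otimes> k = \<zero> \<otimes> k" "k \<otimes> \<zero> \<oplus> k \<otimes> \<zero> = k \<otimes> \<zero>"
      using that rng_l_distr[of \<zero> \<zero> k] rng_r_distr[of \<zero> \<zero> k] by simp_all
    then show "\<zero> \<otimes> k = \<zero>" "k \<otimes> \<zero> = \<zero>"
      using that rng_m_closed by (metis add.l_cancel_one' zero_closed)+
  qed
  note zero = this
  show "rel_center R S T \<noteq> {}"
  proof -
    have "\<zero> \<in> rel_center R S T"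
      using assms(2) zero by (auto simp: rel_center_def)
    then show ?thesis by blast
  qed
  fix a assume a: "a \<in> rel_center R S T"
  then have aS: "a \<in> S" "a \<in> carrier R" using S.a_subset by (auto simp: rel_center_def)
  \<comment> \<open>Both sides are additive inverses of the same element, the common value of the
    two products of \<open>a\<close> and \<open>k\<close>.\<close>
  have "\<ominus> a \<otimes> k = k \<otimes> \<ominus> a" if "k \<in> T" for k
  proof -
    have k: "k \<in> carrier R" using that assms(2) by blast
    have "\<ominus> a \<otimes> k \<oplus> a \<otimes> k = \<zero>" "k \<otimes> \<ominus> a \<oplus> k \<otimes> a = \<zero>"
      using k aS rng_l_distr[of "\<ominus> a" a k] rng_r_distr[of "\<ominus> a" a k] zero
      by (simp_all add: l_neg)
    moreover have "a \<otimes> k = k \<otimes> a" using a that by (auto simp: rel_center_def)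
    ultimately show ?thesis
      using k aS rng_m_closed by (metis a_inv_closed add.right_cancel)
  qed
  then show "\<ominus> a \<in> rel_center R S T"
    using aS by (auto simp: rel_center_def)
  fix b assume b: "b \<in> rel_center R S T"
  then have bS: "b \<in> S" "b \<in> carrier R" using S.a_subset by (auto simp: rel_center_def)
  have "(a \<oplus> b) \<otimes> k = k \<otimes> (a \<oplus> b)" if "k \<in> T" for k
  proof -
    have "k \<in> carrier R" using that assms(2) by blast
    then show ?thesis
      using aS bS a b that rng_l_distr rng_r_distr by (simp add: rel_center_def)
  qed
  then show "a \<oplus> b \<in> rel_center R S T"
    using aS bS by (auto simp: rel_center_def)
qed

lemma card_rel_center_dvd:
  assumes "additive_subgroup S R" "T \<subseteq> carrier R"
  shows "card (rel_center R S T) dvd card S"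
  using card_additive_subgroup_dvd[OF additive_subgroup_rel_center[OF assms] assms(1)]
  by (simp add: rel_center_def)

lemma center_quotient_iso_integer_mod_group:
  assumes S: "additive_subgroup S R" and K: "K \<subseteq> carrier R" and fin: "finite S"
    and card: "card S = p * card (rel_center R S K)" and p: "prime p"
  shows "center_quotient R S K \<cong> integer_mod_group p"
    and "integer_mod_group p \<cong> center_quotient R S K"
proof -
  let ?Z = "rel_center R S K" and ?S = "R\<lparr>carrier := S\<rparr>"
  have eq: "add_monoid ?S = add_monoid R\<lparr>carrier := S\<rparr>" by simp
  interpret S: additive_subgroup S R by fact
  \<comment> \<open>The factor group is formed inside \<open>?S\<close>, so \<open>S\<close> must
    first become an abelian group in its own right, with \<open>?Z\<close> as a subgroup of
    it.\<close>
  have agS: "abelian_group ?S"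
  proof (rule abelian_groupI)
    fix x assume "x \<in> carrier ?S"
    then show "\<exists>y\<in>carrier ?S. y \<oplus>\<^bsub>?S\<^esub> x = \<zero>\<^bsub>?S\<^esub>"
      using S.a_subset by (auto intro!: bexI[of _ "\<ominus> x"] l_neg)
  qed (use S.a_subset in \<open>auto simp: a_assoc subset_iff intro: a_comm\<close>)
  have "subgroup ?Z (add_monoid ?S)"
    unfolding eq
    using add.subgroup_incl additive_subgroup_rel_center[OF S K] S additive_subgroup.a_subgroup
    by (metis (no_types, lifting) rel_center_def mem_Collect_eq subsetI)
  then interpret Z: abelian_subgroup ?Z ?S
    using agS abelian_subgroupI3 additive_subgroupI by blast
  interpret Q: group "center_quotient R S K"
    unfolding center_quotient_def by (rule Z.a_factorgroup_is_group)
  have "order (center_quotient R S K) * card ?Z = card S"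
    using Z.a_lagrange[OF _ Z.is_additive_subgroup] fin
    by (simp add: center_quotient_def A_FactGroup_def' order_def)
  moreover have "card ?Z > 0"
    using fin Z.card_pos by (simp add: rel_center_def)
  ultimately have "order (center_quotient R S K) = p"
    using card by simp
  then show "integer_mod_group p \<cong> center_quotient R S K"
    using Q.prime_order_iso_integer_mod_group p by simp
  then show "center_quotient R S K \<cong> integer_mod_group p"
    by (rule group.iso_sym[OF group_integer_mod_group])
qed

section \<open>The index of the relative center\<close>

lemma card_rel_center_eq_of_comm_prob:
  assumes S: "additive_subgroup S R" and K: "additive_subgroup K R" and fin: "finite (carrier R)"
    and p: "prime p" and least: "\<And>q. prime q \<Longrightarrow> q dvd card (carrier R) \<Longrightarrow> p \<le> q"
    and Pr: "comm_prob R S K = (2 * real p - 1) / (real p)\<^sup>2"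
  shows "card S = p * card (rel_center R S K)"
proof -
  let ?Z = "rel_center R S K" and ?C = "\<lambda>s. rel_center R K {s}"
  interpret S: additive_subgroup S R by fact
  interpret K: additive_subgroup K R by fact
  have finS: "finite S" "finite K" using S.a_subset K.a_subset fin finite_subset by blast+
  have R: "additive_subgroup (carrier R) R"
    using add.subgroup_self by (rule additive_subgroupI)
  have dvd: "card S dvd card (carrier R)" "card K dvd card (carrier R)"
    using card_additive_subgroup_dvd R S K S.a_subset K.a_subset by blast+
  have p1: "p > 1" using p prime_gt_1_nat by blast
  have S0: "card S > 0" "card K > 0"
    using finS S.card_pos K.card_pos by blast+
  \<comment> \<open>The factor \<open>p\<close> keeps the estimate free of division. Off the center,
    the index \<open>t\<close> of the centralizer exceeds 1 and divides the order of the ring, so it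
    is at least \<open>p\<close>.\<close>
  have bound: "p * card (?C s) \<le> (if s \<in> ?Z then p * card K else card K)" if s: "s \<in> S" for s
  proof (cases "s \<in> ?Z")
    case True
    have "card (?C s) \<le> card K"
      using finS by (intro card_mono) (auto simp: rel_center_def)
    then show ?thesis using True by simp
  next
    case False
    have sR: "{s} \<subseteq> carrier R" using s S.a_subset by blast
    obtain t where t: "card K = card (?C s) * t"
      using card_rel_center_dvd[OF K sR] by blast
    obtain k where "k \<in> K" "s \<otimes> k \<noteq> k \<otimes> s"
      using s False by (auto simp: rel_center_def)
    then have "k \<in> K - ?C s" by (auto simp: rel_center_def)
    then have "?C s \<subset> K" by (auto simp: rel_center_def)
    then have "card (?C s) < card K" using finS psubset_card_mono by blast
    then have "t > 1" using t by (cases t; cases "t - 1") auto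
    moreover have "t dvd card (carrier R)" using t dvd dvd_trans dvd_triv_right by metis
    ultimately have "p \<le> t" using least_prime_divisor_le least by blast
    then show ?thesis using t False by simp
  qed
  let ?c = "card {(s, k) \<in> S \<times> K. s \<otimes> k = k \<otimes> s}"
  have ZS: "?Z \<subseteq> S" by (auto simp: rel_center_def)
  have "p * ?c \<le> (\<Sum>s\<in>S. if s \<in> ?Z then p * card K else card K)"
    unfolding card_commuting_pairs[OF finS] sum_distrib_left using bound by (rule sum_mono)
  also have "\<dots> = card ?Z * (p * card K) + card (S - ?Z) * card K"
    using ZS finS by (simp add: sum.If_cases Int_absorb1 Diff_eq)
  finally have le: "p * ?c \<le> card ?Z * (p * card K) + card (S - ?Z) * card K" .
  obtain m where m: "card S = card ?Z * m"
    using card_rel_center_dvd[OF S K.a_subset] by blast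
  have Z0: "card ?Z > 0" using m S0 by (cases "card ?Z") auto
  \<comment> \<open>Passing to the reals avoids truncated subtraction in
    \<open>m - 1\<close>.\<close>
  have card_Diff: "real (card (S - ?Z)) = real (card ?Z) * (real m - 1)"
  proof -
    have "card S = card ?Z + card (S - ?Z)"
      using ZS finS by (metis card_Diff_subset card_mono finite_subset le_add_diff_inverse)
    then have "real (card ?Z * m) = real (card ?Z) + real (card (S - ?Z))"
      using m by (metis of_nat_add)
    then show ?thesis by (simp add: algebra_simps)
  qed
  have c: "real ?c * (real p)\<^sup>2 = (2 * real p - 1) * (real (card S) * real (card K))"
    using Pr S0 p1 unfolding comm_prob_def by (simp add: card_cartesian_product field_simps)
  define z k where "z = real (card ?Z)" and "k = real (card K)"
  have zk: "z * k > 0" using Z0 S0 by (simp add: z_def k_def)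
  have "real p * real ?c \<le> z * (real p * k) + z * (real m - 1) * k"
    using le[folded of_nat_le_iff[where ?'a = real]] card_Diff by (simp add: z_def k_def)
  \<comment> \<open>A second factor \<open>p\<close> produces the denominator of the given
    probability. After cancelling \<open>z * k\<close> this reads (2p - 1) m <= p^2 + p (m - 1),
    that is, (p - 1) m <= (p - 1) p.\<close>
  then have "real p * (real p * real ?c) \<le> real p * (z * (real p * k) + z * (real m - 1) * k)"
    by (rule mult_left_mono) simp
  moreover have "real p * (real p * real ?c) = (2 * real p - 1) * (z * real m * k)"
    using c m by (simp add: power2_eq_square z_def k_def algebra_simps)
  ultimately have "(z * k) * ((real p - 1) * real m) \<le> (z * k) * ((real p - 1) * real p)"
    by (simp add: algebra_simps)
  then have "(real p - 1) * real m \<le> (real p - 1) * real p"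
    using zk mult_le_cancel_left_pos by blast
  then have mp: "m \<le> p" using p1 by simp
  have "m \<noteq> 1"
  proof
    assume "m = 1"
    then have "?Z = S" using m card_subset_eq[OF finS(1) ZS] by simp
    then have "comm_prob R S K = 1"
      using comm_prob_eq_1 finS S0 by (metis card.empty less_irrefl)
    then have "(real p - 1)\<^sup>2 = 0"
      using Pr p1 by (simp add: field_simps power2_eq_square)
    then show False using p1 by simp
  qed
  moreover have "m \<noteq> 0" using m S0 by (cases m) auto
  \<comment> \<open>As a divisor of the order of the ring other than 1, \<open>m\<close> cannot lie
    below the smallest prime divisor \<open>p\<close>.\<close>
  moreover have "m dvd card (carrier R)" using m dvd dvd_trans dvd_triv_right by metis
  ultimately have "p \<le> m" using least_prime_divisor_le[OF least] by simp
  then show ?thesis using mp m by simp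
qed

text \<open>Analogue of the fact that a group modulo its center never has prime order; it rules out
  \<open>S = K\<close>.\<close>

lemma card_rel_center_self_neq_prime:
  assumes S: "additive_subgroup S R" and fin: "finite S" and p: "prime p"
  shows "card S \<noteq> p * card (rel_center R S S)"
proof
  let ?Z = "rel_center R S S"
  assume eq: "card S = p * card ?Z"
  interpret S: additive_subgroup S R by fact
  have ZS: "?Z \<subseteq> S" by (auto simp: rel_center_def)
  have "card S > 0" using fin S.card_pos by blast
  then have Z0: "card ?Z > 0" using eq by simp
  have "?Z \<noteq> S" using eq p Z0 by auto
  then obtain s where s: "s \<in> S" "s \<notin> ?Z" using ZS by blast
  let ?C = "rel_center R S {s}"
  have sR: "{s} \<subseteq> carrier R" using s S.a_subset by blast
  \<comment> \<open>The inclusion is strict because \<open>s\<close> commutes with itself but is not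
    central. As the center has prime index, no additive subgroup lies strictly between it and
    \<open>S\<close>, so \<open>?C\<close> must be \<open>S\<close>.\<close>
  have C: "?Z \<subset> ?C" using s by (auto simp: rel_center_def)
  have CS: "?C \<subseteq> S" by (auto simp: rel_center_def)
  obtain t where t: "card ?C = card ?Z * t"
    using card_additive_subgroup_dvd[OF additive_subgroup_rel_center[OF S S.a_subset]
        additive_subgroup_rel_center[OF S sR]] C by blast
  have "card ?C dvd card S" using card_rel_center_dvd[OF S sR] .
  then have "t dvd p" using t eq Z0 by (simp add: mult.commute)
  moreover have "card ?Z < card ?C" using C CS fin by (meson finite_subset psubset_card_mono)
  then have "t \<noteq> 1" using t by auto
  ultimately have "card ?C = card S" using p t eq by (auto simp: prime_nat_iff)
  then have "?C = S" using card_subset_eq fin CS by blast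
  then have "k \<otimes> s = s \<otimes> k" if "k \<in> S" for k
    using that by (auto simp: rel_center_def)
  then have "s \<in> ?Z" using s by (auto simp: rel_center_def)
  then show False using s by blast
qed

end

theorem theorem3p11:
  fixes R :: "('a, 'b) ring_scheme" (structure) and S K :: "'a set"
  assumes "rng R"
    and "finite (carrier R)"
    and "\<not> (\<forall>x\<in>carrier R. \<forall>y\<in>carrier R. x \<otimes> y = y \<otimes> x)"
    and "subrng S R"
    and "subrng K R"
  shows
    "(\<forall>p::nat. prime p \<and> comm_prob R S K = (2 * real p - 1) / (real p)\<^sup>2 \<longrightarrow>
        p dvd card (carrier R) \<and>
        ((\<forall>q::nat. prime q \<and> q dvd card (carrier R) \<longrightarrow> p \<le> q) \<longrightarrow>
           center_quotient R S K \<cong> integer_mod_group p \<and>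
           integer_mod_group p \<cong> center_quotient R K S \<and>
           S \<noteq> K)) \<and>
     (comm_prob R S K = 3 / 4 \<longrightarrow>
        center_quotient R S K \<cong> integer_mod_group 2 \<and>
        integer_mod_group 2 \<cong> center_quotient R K S)"
proof -
  interpret rng R by fact
  interpret S: subrng S R by fact
  interpret K: subrng K R by fact
  note S = S.is_additive_subgroup and K = K.is_additive_subgroup
  have fin: "finite S" "finite K"
    using S.a_subset K.a_subset assms(2) finite_subset by blast+
  have quotients: "center_quotient R S K \<cong> integer_mod_group p"
      "integer_mod_group p \<cong> center_quotient R K S" "S \<noteq> K"
    if p: "prime p" and Pr: "comm_prob R S K = (2 * real p - 1) / (real p)\<^sup>2"
      and least: "\<And>q. prime q \<Longrightarrow> q dvd card (carrier R) \<Longrightarrow> p \<le> q" for p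
  proof -
    have cS: "card S = p * card (rel_center R S K)"
      by (rule card_rel_center_eq_of_comm_prob[OF S K assms(2) p least Pr])
    have cK: "card K = p * card (rel_center R K S)"
      by (rule card_rel_center_eq_of_comm_prob[OF K S assms(2) p least Pr[unfolded comm_prob_commute[of R S]]])
    show "center_quotient R S K \<cong> integer_mod_group p"
      by (rule center_quotient_iso_integer_mod_group(1)[OF S K.a_subset fin(1) cS p])
    show "integer_mod_group p \<cong> center_quotient R K S"
      by (rule center_quotient_iso_integer_mod_group(2)[OF K S.a_subset fin(2) cK p])
    show "S \<noteq> K"
      using card_rel_center_self_neq_prime[OF S fin(1) p] cS by blast
  qed
  \<comment> \<open>Clearing denominators shows that \<open>p\<close> divides (2p - 1) |S| |K|. It
    is coprime to 2p - 1, so it divides |S| or |K|, and Lagrange carries this over to the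
    ring.\<close>
  have dvd: "p dvd card (carrier R)"
    if p: "prime p" and Pr: "comm_prob R S K = (2 * real p - 1) / (real p)\<^sup>2" for p
  proof -
    let ?c = "card {(s, k) \<in> S \<times> K. s \<otimes> k = k \<otimes> s}"
    have p1: "p > 1" using p prime_gt_1_nat by blast
    have "card S > 0" "card K > 0"
      using fin S.card_pos K.card_pos by blast+
    then have "real ?c * (real p)\<^sup>2 = (2 * real p - 1) * (real (card S) * real (card K))"
      using Pr p1 unfolding comm_prob_def by (simp add: card_cartesian_product field_simps)
    also have "\<dots> = real ((2 * p - 1) * (card S * card K))"
      using p1 by (simp add: of_nat_diff)
    finally have "?c * p\<^sup>2 = (2 * p - 1) * (card S * card K)"
      by (simp only: of_nat_mult[symmetric] of_nat_power[symmetric] of_nat_eq_iff)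
    moreover have "p dvd ?c * p\<^sup>2" by (simp add: power2_eq_square)
    ultimately have "p dvd (2 * p - 1) * (card S * card K)" by simp
    moreover have "\<not> p dvd 2 * p - 1"
    proof
      assume "p dvd 2 * p - 1"
      then have "p dvd 2 * p - (2 * p - 1)" by (rule dvd_diff_nat[OF dvd_triv_right])
      moreover have "2 * p - (2 * p - 1) = 1" using p1 by linarith
      ultimately show False using p1 by simp
    qed
    ultimately have "p dvd card S \<or> p dvd card K"
      using p prime_dvd_mult_iff by blast
    moreover have "card S dvd card (carrier R)" "card K dvd card (carrier R)"
      using card_additive_subgroup_dvd[OF S additive_subgroupI[OF add.subgroup_self] S.a_subset]
        card_additive_subgroup_dvd[OF K additive_subgroupI[OF add.subgroup_self] K.a_subset] .
    ultimately show ?thesis using dvd_trans by blast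
  qed
  have two: "center_quotient R S K \<cong> integer_mod_group 2 \<and> integer_mod_group 2 \<cong> center_quotient R K S"
    if "comm_prob R S K = 3 / 4"
  proof -
    \<comment> \<open>The value 3/4 is the case p = 2, where minimality is automatic because no
      prime is smaller than 2.\<close>
    have Pr: "comm_prob R S K = (2 * real 2 - 1) / (real 2)\<^sup>2" using that by simp
    show ?thesis
      using quotients(1,2)[OF two_is_prime_nat Pr] prime_ge_2_nat by blast
  qed
  then show ?thesis
  proof (intro conjI allI impI; (elim conjE)?)
    fix p :: nat
    assume p: "prime p" and Pr: "comm_prob R S K = (2 * real p - 1) / (real p)\<^sup>2"
    show "p dvd card (carrier R)" using p Pr by (rule dvd)
    assume "\<forall>q. prime q \<and> q dvd card (carrier R) \<longrightarrow> p \<le> q"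
    then have least: "\<And>q. prime q \<Longrightarrow> q dvd card (carrier R) \<Longrightarrow> p \<le> q" by blast
    show "center_quotient R S K \<cong> integer_mod_group p"
      "integer_mod_group p \<cong> center_quotient R K S" "S \<noteq> K"
      by (rule quotients[OF p Pr least]; assumption)+
  qed (use two in blast)+
qed

end
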